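(* Let $p\in\mathbb{R}$. If $p\neq 0$ and $p\neq 1$, the function $F:\mathbb{R}^{N^2}\to\mathbb{R}$ defined by $$F(x)=\frac{N}{p}\,|\det x|^{p/N}$$ has a Legendre transform $F^L:\mathbb{R}^{N^2}\to\mathbb{R}$ defined by $$F^L(y)=\frac{N}{q}\,|\det y|^{q/N},$$ with $\frac1p+\frac1q=1$.
   Context: Here $N$ is a positive integer and $\mathbb{R}^{N^2}$ is identified with the space of real $N\times N$ matrices. Matrices $x=(x_n^k)$ and $y=(y_k^n)$ are paired by $\langle x,y\rangle=\sum_{n,k}x_n^k y_k^n$, and the derivative $F'(x)$ is the matrix with entries $y_k^n=\partial F/\partial x_n^k$. Definition (Legendre transform). Let $X$ be a finite-dimensional real vector space with dual $Y$ and duality pairing $\langle x,y\rangle$. Consider a map $F:\Omega\to\mathbb{R}$, where $\Omega$ is a submanifold of $X$, and set $\Sigma=F'(\Omega)$, where $F'(x)\in Y$ denotes the derivative of $F$ at $x$. A $C^1$ function $G:\Sigma\to\mathbb{R}$ is the Legendre transform of $F$, denoted $F^L$, if $\Sigma$ is a submanifold of $Y$ and $$[x\in\Omega,\ y=F'(x)]\ \Longrightarrow\ \langle x,y\rangle-F(x)=G(y).$$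
   Formalization: F and F^L are taken on invertible matrices, not all of R^{N^2}, since F is not differentiable (N=p=2 at diag(1,0)) or not defined (p<0) at singular ones; the identity is also proved at every singular x where F is differentiable. For N=1, p>1 smoothness at 0 is not asserted. *)

theory Defs
  imports "HOL-Analysis.Analysis"
begin

text \<open>Only meant for open \<open>S\<close>, where \<open>at x\<close> and \<open>at x within S\<close> agree for \<open>x \<in> S\<close>.\<close>

primrec Ck_on :: "nat \<Rightarrow> ('a::euclidean_space \<Rightarrow> 'b::real_normed_vector) \<Rightarrow> 'a set \<Rightarrow> bool" where
  "Ck_on 0 f S \<longleftrightarrow> continuous_on S f"
| "Ck_on (Suc k) f S \<longleftrightarrow>
     f differentiable_on S \<and> (\<forall>v. Ck_on k (\<lambda>x. frechet_derivative f (at x) v) S)"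

definition smooth_on :: "('a::euclidean_space \<Rightarrow> 'b::real_normed_vector) \<Rightarrow> 'a set \<Rightarrow> bool" where
  "smooth_on f S \<longleftrightarrow> (\<forall>k. Ck_on k f S)"

text \<open>Embedded submanifolds: locally flattened onto a linear subspace by a diffeomorphism
  between open sets of the ambient space.\<close>

definition smooth_submanifold :: "'a::euclidean_space set \<Rightarrow> bool" where
  "smooth_submanifold M \<longleftrightarrow>
     (\<exists>d. \<forall>x\<in>M. \<exists>U V \<phi> \<psi> L.
        open U \<and> x \<in> U \<and> open (V :: 'a set) \<and>
        homeomorphism U V \<phi> \<psi> \<and> smooth_on \<phi> U \<and> smooth_on \<psi> V \<and>
        subspace L \<and> dim L = d \<and> \<phi> ` (M \<inter> U) = L \<inter> V)"

text \<open>On an embedded submanifold, \<open>C\<^sup>1\<close> means: locally the restriction of an ambient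
  \<open>C\<^sup>1\<close> function.\<close>

definition C1_on_submanifold :: "'a::euclidean_space set \<Rightarrow> ('a \<Rightarrow> real) \<Rightarrow> bool" where
  "C1_on_submanifold M g \<longleftrightarrow>
     (\<forall>x\<in>M. \<exists>U h. open U \<and> x \<in> U \<and> Ck_on 1 h U \<and> (\<forall>u \<in> M \<inter> U. h u = g u))"

text \<open>A perfect pairing, identifying \<open>'b\<close> with the dual of \<open>'a\<close>.\<close>

definition duality_pairing :: "('a::euclidean_space \<Rightarrow> 'b::euclidean_space \<Rightarrow> real) \<Rightarrow> bool" where
  "duality_pairing B \<longleftrightarrow> bilinear B \<and>
     (\<forall>x. (\<forall>y. B x y = 0) \<longrightarrow> x = 0) \<and> (\<forall>y. (\<forall>x. B x y = 0) \<longrightarrow> y = 0)"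

text \<open>\<open>y\<close> represents, under the pairing, the derivative at \<open>x\<close> of a function on \<open>\<Omega>\<close>.
  For open \<open>\<Omega>\<close> this \<open>y\<close> is unique. For a lower-dimensional \<open>\<Omega>\<close> it is determined only up
  to the annihilator of the tangent space of \<open>\<Omega>\<close> at \<open>x\<close>.\<close>

definition has_dual_derivative ::
  "('a::euclidean_space \<Rightarrow> 'b::euclidean_space \<Rightarrow> real) \<Rightarrow> 'a set \<Rightarrow> ('a \<Rightarrow> real) \<Rightarrow> 'a \<Rightarrow> 'b \<Rightarrow> bool" where
  "has_dual_derivative B \<Omega> F x y \<longleftrightarrow> (F has_derivative (\<lambda>h. B h y)) (at x within \<Omega>)"

text \<open>\<open>G\<close>, with domain \<open>\<Sigma>\<close>, is the Legendre transform of \<open>F\<close>, with domain \<open>\<Omega>\<close>.\<close>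

definition is_Legendre_transform ::
  "('a::euclidean_space \<Rightarrow> 'b::euclidean_space \<Rightarrow> real) \<Rightarrow>
     'a set \<Rightarrow> ('a \<Rightarrow> real) \<Rightarrow> 'b set \<Rightarrow> ('b \<Rightarrow> real) \<Rightarrow> bool" where
  "is_Legendre_transform B \<Omega> F \<Sigma> G \<longleftrightarrow>
     duality_pairing B \<and>
     smooth_submanifold \<Omega> \<and>
     (\<forall>x\<in>\<Omega>. \<exists>y. has_dual_derivative B \<Omega> F x y) \<and>
     \<Sigma> = {y. \<exists>x\<in>\<Omega>. has_dual_derivative B \<Omega> F x y} \<and>
     smooth_submanifold \<Sigma> \<and>
     C1_on_submanifold \<Sigma> G \<and>
     (\<forall>x\<in>\<Omega>. \<forall>y. has_dual_derivative B \<Omega> F x y \<longrightarrow> B x y - F x = G y)"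

definition matrix_pairing :: "real^'n^'n \<Rightarrow> real^'n^'n \<Rightarrow> real" where
  "matrix_pairing x y = (\<Sum>n\<in>UNIV. \<Sum>k\<in>UNIV. x $ n $ k * y $ k $ n)"

end

theory Submission
  imports Defs
begin

text \<open>By Jacobi's formula the gradient of \<open>N/p \<bar>det x\<bar>\<^sup>p\<^sup>/\<^sup>N\<close> at an invertible \<open>x\<close> is
  \<open>y = \<bar>det x\<bar>\<^sup>p\<^sup>/\<^sup>N x\<^sup>-\<^sup>1\<close>. Hence \<open>\<langle>x, y\<rangle> = N \<bar>det x\<bar>\<^sup>p\<^sup>/\<^sup>N\<close> and \<open>\<bar>det y\<bar> = \<bar>det x\<bar>\<^sup>p\<^sup>-\<^sup>1\<close>, and since
  \<open>(p - 1)(q - 1) = 1\<close>, the gradient maps for \<open>p\<close> and \<open>q\<close> are inverse to each other.\<close>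

section \<open>Open sets as submanifolds\<close>

lemma Ck_on_const: "Ck_on k (\<lambda>x. c) S"
  by (induction k arbitrary: c) (auto simp: frechet_derivative_const)

lemma smooth_on_id: "smooth_on id S"
proof -
  have "Ck_on k id S" for k
  proof (cases k)
    case (Suc m)
    then show ?thesis
      by (auto simp: id_def differentiable_on_def frechet_derivative_ident Ck_on_const)
  qed (simp add: continuous_on_id)
  then show ?thesis
    by (simp add: smooth_on_def)
qed

lemma smooth_submanifold_open:
  fixes S :: "'a::euclidean_space set"
  assumes "open S"
  shows "smooth_submanifold S"
proof -
  \<comment> \<open>The identity is a global chart, flattening onto the full space as the linear
    subspace.\<close>
  have "open S \<and> x \<in> S \<and> open S \<and> homeomorphism S S id id \<and> smooth_on id S \<and> smooth_on id S \<and>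
      subspace (UNIV :: 'a set) \<and> dim (UNIV :: 'a set) = DIM('a) \<and> id ` (S \<inter> S) = UNIV \<inter> S"
    if "x \<in> S" for x
    using assms that by (simp add: homeomorphism_def smooth_on_id)
  then show ?thesis
    unfolding smooth_submanifold_def by (intro exI ballI)
qed

section \<open>The trace pairing on matrices\<close>

lemma matrix_pairing_eq_trace: "matrix_pairing x y = trace (x ** y)"
  by (simp add: matrix_pairing_def trace_def matrix_matrix_mult_def)

lemma trace_scaleR: "trace (c *\<^sub>R x) = c * trace x" for x :: "real^'n^'n"
  by (simp add: trace_def sum_distrib_left)

lemma matrix_pairing_commute: "matrix_pairing x y = matrix_pairing y x"
  unfolding matrix_pairing_eq_trace by (rule trace_mul_sym)

lemma bilinear_matrix_pairing:
  "bilinear (matrix_pairing :: real^'n^'n \<Rightarrow> real^'n^'n \<Rightarrow> real)"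
proof -
  have lin: "linear (matrix_pairing x)" for x :: "real^'n^'n"
    by (simp add: linear_iff matrix_pairing_eq_trace matrix_add_ldistrib trace_add
        matrix_scalar_ac scalar_matrix_assoc[symmetric] trace_scaleR)
  moreover have "linear (\<lambda>x. matrix_pairing x y)" for y :: "real^'n^'n"
    using lin[of y] by (subst matrix_pairing_commute)
  ultimately show ?thesis
    by (simp add: bilinear_def)
qed

lemma matrix_pairing_nondegenerate:
  fixes y :: "real^'n^'n"
  assumes "\<And>x. matrix_pairing x y = 0"
  shows "y = 0"
proof -
  \<comment> \<open>Testing \<open>y\<close> against its transpose gives the squared Frobenius
    norm.\<close>
  have "matrix_pairing (transpose y) y = y \<bullet> y"
    by (subst matrix_pairing_commute) (simp add: matrix_pairing_def transpose_def inner_vec_def)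
  then show ?thesis
    by (simp add: assms)
qed

lemma duality_pairing_matrix_pairing:
  "duality_pairing (matrix_pairing :: real^'n^'n \<Rightarrow> real^'n^'n \<Rightarrow> real)"
  unfolding duality_pairing_def
proof (intro conjI allI impI bilinear_matrix_pairing)
  fix x :: "real^'n^'n"
  assume "\<forall>y. matrix_pairing x y = 0"
  then show "x = 0"
    by (intro matrix_pairing_nondegenerate) (subst matrix_pairing_commute, blast)
qed (blast intro: matrix_pairing_nondegenerate)

section \<open>Jacobi's formula for the derivative of the determinant\<close>

definition det_deriv :: "real^'n^'n \<Rightarrow> real^'n^'n \<Rightarrow> real" where
  "det_deriv x h = (\<Sum>p | p permutes UNIV. of_int (sign p) *
     (\<Sum>i\<in>UNIV. h $ i $ p i * (\<Prod>j\<in>UNIV - {i}. x $ j $ p j)))"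

text \<open>The Leibniz expansion is differentiated term by term with the product rule;
  \<open>det_deriv\<close> is the resulting sum, meaningful at singular matrices too.\<close>

lemma has_derivative_det: "(det has_derivative det_deriv x) (at x)" for x :: "real^'n^'n"
proof -
  have "bounded_linear (\<lambda>x::real^'n^'n. x $ i $ j)" for i j
    by (intro bounded_linear_compose[OF bounded_linear_vec_nth] bounded_linear_vec_nth)
  then have "((\<lambda>x::real^'n^'n. x $ i $ j) has_derivative (\<lambda>h. h $ i $ j)) (at x)" for i j
    by (rule bounded_linear_imp_has_derivative)
  then show ?thesis
    unfolding det_def[abs_def] det_deriv_def[abs_def]
    by (intro has_derivative_sum has_derivative_mult_right has_derivative_prod)
qed

lemma continuous_on_det: "continuous_on S (det :: real^'n^'n \<Rightarrow> real)"
  by (meson continuous_at_imp_continuous_on has_derivative_continuous has_derivative_det)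

lemma continuous_on_det_deriv: "continuous_on S (\<lambda>x. det_deriv x h)"
  unfolding det_deriv_def by (intro continuous_intros)

lemma open_det_nonzero: "open {x :: real^'n^'n. det x \<noteq> 0}"
  by (intro open_Collect_neq continuous_on_det continuous_on_const)

text \<open>Only the identity permutation contributes: any other one moves at least two indices, so
  after one factor of its product is deleted an off-diagonal zero remains.\<close>

lemma det_deriv_mat_1: "det_deriv (mat 1) h = trace h" for h :: "real^'n^'n"
proof -
  let ?t = "\<lambda>p. of_int (sign p) *
     (\<Sum>i\<in>UNIV. h $ i $ p i * (\<Prod>j\<in>UNIV - {i}. (mat 1 :: real^'n^'n) $ j $ p j))"
  have "?t p = 0" if p: "p permutes UNIV" "p \<noteq> id" for p
  proof -
    obtain a where a: "p a \<noteq> a"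
      using p(2) by fastforce
    then have b: "p (p a) \<noteq> p a"
      using permutes_inj[OF p(1)] by (simp add: inj_eq)
    have "(\<Prod>j\<in>UNIV - {i}. (mat 1 :: real^'n^'n) $ j $ p j) = 0" for i
    proof -
      have "\<exists>j\<in>UNIV - {i}. (mat 1 :: real^'n^'n) $ j $ p j = 0"
        \<comment> \<open>Both \<open>a\<close> and \<open>p a\<close> are moved by
          \<open>p\<close>; at least one of them differs from the deleted index
          \<open>i\<close>.\<close>
        by (rule bexI[of _ "if i = a then p a else a"]) (use a b in \<open>auto simp: mat_def\<close>)
      then show ?thesis
        by (intro prod_zero) auto
    qed
    then show ?thesis
      by (simp only: mult_zero_right sum.neutral_const)
  qed
  then have "det_deriv (mat 1) h = (\<Sum>p\<in>{id}. ?t p)"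
    unfolding det_deriv_def
    by (intro sum.mono_neutral_right) (auto simp: permutes_id)
  then show ?thesis
    by (simp add: sign_id mat_def trace_def)
qed

lemma matrix_inv_mult:
  fixes x :: "real^'n^'n"
  assumes "det x \<noteq> 0"
  shows "x ** matrix_inv x = mat 1" "matrix_inv x ** x = mat 1"
proof -
  have "x ** matrix_inv x = mat 1 \<and> matrix_inv x ** x = mat 1"
    using assms unfolding invertible_det_nz[symmetric] invertible_def matrix_inv_def
    by (rule someI_ex)
  then show "x ** matrix_inv x = mat 1" "matrix_inv x ** x = mat 1"
    by auto
qed

text \<open>Reduction to the identity matrix:
  \<open>det z = det x * det (matrix_inv x ** z)\<close>, and the inner argument is
  \<open>mat 1\<close> at \<open>z = x\<close>. The chain rule and uniqueness of the derivative give
  the formula.\<close>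

lemma det_deriv_invertible:
  fixes x h :: "real^'n^'n"
  assumes "det x \<noteq> 0"
  shows "det_deriv x h = det x * matrix_pairing h (matrix_inv x)"
proof -
  let ?L = "\<lambda>z::real^'n^'n. matrix_inv x ** z"
  have lin: "linear ?L"
    by (simp add: linear_iff matrix_add_ldistrib matrix_scalar_ac scalar_matrix_assoc[symmetric])
  have "(?L has_derivative ?L) (at x)"
    using lin by (simp add: linear_conv_bounded_linear bounded_linear_imp_has_derivative)
  moreover have "(det has_derivative trace) (at (?L x))"
    using has_derivative_det[of "mat 1 :: real^'n^'n"]
    by (simp add: matrix_inv_mult[OF assms] det_deriv_mat_1[abs_def])
  ultimately have "((\<lambda>z. det (?L z)) has_derivative (\<lambda>h. trace (?L h))) (at x)"
    by (rule has_derivative_compose)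
  then have "((\<lambda>z. det x * det (?L z)) has_derivative (\<lambda>h. det x * trace (?L h))) (at x)"
    by (rule has_derivative_mult_right)
  moreover have "det x * det (?L z) = det z" for z
  proof -
    have "det x * det (?L z) = det (x ** matrix_inv x ** z)"
      by (simp add: det_mul mult.assoc)
    then show ?thesis
      by (simp add: matrix_inv_mult[OF assms])
  qed
  ultimately have "(det has_derivative (\<lambda>h. det x * trace (?L h))) (at x)"
    by simp
  then have "det_deriv x = (\<lambda>h. det x * trace (?L h))"
    using has_derivative_det has_derivative_unique by blast
  then show ?thesis
    by (simp add: matrix_pairing_eq_trace trace_mul_sym[of h])
qed

lemma det_matrix_inv:
  fixes x :: "real^'n^'n"
  assumes "det x \<noteq> 0"
  shows "det (matrix_inv x) = 1 / det x"
proof -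
  have "det x * det (matrix_inv x) = 1"
    by (simp add: det_mul[symmetric] matrix_inv_mult[OF assms])
  then show ?thesis
    using assms by (simp add: field_simps)
qed

lemma matrix_inv_unique:
  fixes x y :: "real^'n^'n"
  assumes "x ** y = mat 1"
  shows "matrix_inv x = y"
proof -
  have "det x * det y = 1"
    by (simp add: det_mul[symmetric] assms)
  then have "matrix_inv x ** x = mat 1"
    by (intro matrix_inv_mult) auto
  then have "matrix_inv x ** (x ** y) = y"
    by (simp add: matrix_mul_assoc)
  then show ?thesis
    by (simp add: assms)
qed

lemma det_scaleR: "det (c *\<^sub>R x) = c ^ CARD('n) * det x" for x :: "real^'n^'n"
proof -
  have "c *\<^sub>R x = (c *\<^sub>R mat 1) ** x"
    by (simp flip: scalar_matrix_assoc)
  also have "c *\<^sub>R mat 1 = (matrix ((*\<^sub>R) c) :: real^'n^'n)"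
    by (simp add: matrix_scaleR mat_def vec_eq_iff)
  finally show ?thesis
    by (simp add: det_mul)
qed

section \<open>Powers of the absolute determinant are continuously differentiable on the invertible
  matrices\<close>

lemma has_derivative_abs_det_powr:
  fixes x :: "real^'n^'n"
  assumes "det x \<noteq> 0"
  shows "((\<lambda>z. \<bar>det z\<bar> powr a) has_derivative
    (\<lambda>h. a * \<bar>det x\<bar> powr a / det x * det_deriv x h)) (at x)"
proof -
  \<comment> \<open>Near \<open>x\<close> the determinant keeps its sign, so the absolute value
    there is multiplication by the constant \<open>?s\<close>.\<close>
  let ?s = "sgn (det x)"
  let ?S = "{z :: real^'n^'n. 0 < ?s * det z}"
  have op: "open ?S"
    by (intro open_Collect_less continuous_intros continuous_on_det)
  have x: "x \<in> ?S"
    using assms by (simp add: sgn_if)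
  have abs: "?s * det z = \<bar>det z\<bar>" if "z \<in> ?S" for z
    using that by (auto simp: sgn_if split: if_splits)
  \<comment> \<open>This is the rule for a variable exponent; the exponent is constant, hence the
    factor 0 at the logarithm.\<close>
  have "((\<lambda>z. (?s * det z) powr a) has_derivative
      (\<lambda>h. (?s * det x) powr a * (0 * ln (?s * det x) + (?s * det_deriv x h) * a / (?s * det x))))
      (at x)"
    using x by (intro has_derivative_powr has_derivative_mult_right has_derivative_det
        has_derivative_const) auto
  then have "((\<lambda>z. \<bar>det z\<bar> powr a) has_derivative
      (\<lambda>h. (?s * det x) powr a * (0 * ln (?s * det x) + (?s * det_deriv x h) * a / (?s * det x))))
      (at x)"
    by (rule has_derivative_transform_within_open[OF _ op x]) (simp only: abs)
  moreover have "(?s * det x) powr a * (0 * ln (?s * det x) + (?s * det_deriv x h) * a / (?s * det x))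
      = a * \<bar>det x\<bar> powr a / det x * det_deriv x h" for h
    using assms by (simp add: abs[OF x] sgn_if)
  ultimately show ?thesis
    by simp
qed

lemma Ck_on_1_abs_det_powr:
  "Ck_on 1 (\<lambda>y :: real^'n^'n. c * \<bar>det y\<bar> powr a) {y. det y \<noteq> 0}"
proof -
  let ?S = "{y :: real^'n^'n. det y \<noteq> 0}"
  let ?f = "\<lambda>y :: real^'n^'n. c * \<bar>det y\<bar> powr a"
  let ?D = "\<lambda>y h. c * (a * \<bar>det y\<bar> powr a / det y * det_deriv y h)"
  have D: "(?f has_derivative ?D y) (at y)" if "y \<in> ?S" for y
    using that by (intro has_derivative_mult_right has_derivative_abs_det_powr) simp
  then have "?f differentiable_on ?S"
    by (meson differentiable_at_imp_differentiable_on differentiable_def)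
  moreover have "continuous_on ?S (\<lambda>y. frechet_derivative ?f (at y) v)" for v
  proof -
    have "continuous_on ?S (\<lambda>y. ?D y v)"
      by (intro continuous_intros continuous_on_det continuous_on_det_deriv) auto
    moreover have "?D y v = frechet_derivative ?f (at y) v" if "y \<in> ?S" for y
      using fun_cong[OF frechet_derivative_at[OF D[OF that]], of v] .
    ultimately show ?thesis
      by (rule continuous_on_eq)
  qed
  ultimately show ?thesis
    by simp
qed

section \<open>The gradient map and its inverse\<close>

definition det_gradient :: "real \<Rightarrow> real^'n^'n \<Rightarrow> real^'n^'n" where
  "det_gradient r x = \<bar>det x\<bar> powr (r / real CARD('n)) *\<^sub>R matrix_inv x"

lemma matrix_pairing_det_gradient:
  fixes x :: "real^'n^'n"
  assumes "det x \<noteq> 0"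
  shows "matrix_pairing x (det_gradient r x) = real CARD('n) * \<bar>det x\<bar> powr (r / real CARD('n))"
  by (simp add: matrix_pairing_eq_trace det_gradient_def matrix_scalar_ac
      scalar_matrix_assoc[symmetric] matrix_inv_mult[OF assms] trace_scaleR trace_I)

text \<open>The scalar factor enters the determinant to the power \<open>CARD('n)\<close>, giving
  exponent \<open>r\<close>; the inverse matrix lowers it by one.\<close>

lemma abs_det_det_gradient:
  fixes x :: "real^'n^'n"
  assumes "det x \<noteq> 0"
  shows "\<bar>det (det_gradient r x)\<bar> = \<bar>det x\<bar> powr (r - 1)"
proof -
  have "(\<bar>det x\<bar> powr (r / real CARD('n))) ^ CARD('n) = \<bar>det x\<bar> powr r"
    using assms by (simp add: powr_realpow[symmetric] powr_powr)
  then show ?thesis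
    using assms
    by (simp add: det_gradient_def det_scaleR det_matrix_inv abs_mult powr_diff)
qed

text \<open>The second hypothesis is conjugacy of \<open>r\<close> and \<open>s\<close> cleared of
  denominators. It makes the outer scalar \<open>\<bar>det x\<bar> powr ((r - 1) * s / N)\<close>,
  with \<open>N = CARD('n)\<close>, equal to the inner one, which cancels against its reciprocal in
  the inverse matrix.\<close>

lemma det_gradient_involution:
  fixes x :: "real^'n^'n"
  assumes "det x \<noteq> 0" and "(r - 1) * s = r"
  shows "det_gradient s (det_gradient r x) = x"
proof -
  let ?c = "\<bar>det x\<bar> powr (r / real CARD('n))"
  have c: "?c \<noteq> 0"
    using assms by simp
  have "matrix_inv (det_gradient r x) = (1 / ?c) *\<^sub>R x"
    using c by (intro matrix_inv_unique)
      (simp add: det_gradient_def matrix_scalar_ac scalar_matrix_assoc[symmetric]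
        matrix_inv_mult[OF assms(1)])
  moreover have "\<bar>det (det_gradient r x)\<bar> powr (s / real CARD('n)) = ?c"
    using assms by (simp add: abs_det_det_gradient powr_powr)
  ultimately show ?thesis
    using c by (simp add: det_gradient_def[of s])
qed

text \<open>Jacobi's formula shows that the gradient represents the derivative. It is the only
  representative because the domain is open and the pairing is nondegenerate.\<close>

lemma has_dual_derivative_abs_det_powr_iff:
  fixes x y :: "real^'n^'n"
  assumes "r \<noteq> 0" and "det x \<noteq> 0"
  shows "has_dual_derivative matrix_pairing {x. det x \<noteq> 0}
      (\<lambda>x. real CARD('n) / r * \<bar>det x\<bar> powr (r / real CARD('n))) x y \<longleftrightarrow> y = det_gradient r x"
proof -
  let ?F = "\<lambda>x :: real^'n^'n. real CARD('n) / r * \<bar>det x\<bar> powr (r / real CARD('n))"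
  have pair: "matrix_pairing h (det_gradient r x) = real CARD('n) / r *
      (r / real CARD('n) * \<bar>det x\<bar> powr (r / real CARD('n)) / det x * det_deriv x h)" for h
    using assms
    by (simp add: det_deriv_invertible det_gradient_def matrix_pairing_eq_trace matrix_scalar_ac
        scalar_matrix_assoc[symmetric] trace_scaleR)
  have D: "(?F has_derivative (\<lambda>h. matrix_pairing h (det_gradient r x))) (at x)"
    unfolding pair
    by (intro has_derivative_mult_right has_derivative_abs_det_powr assms)
  have "y = det_gradient r x"
    if "(?F has_derivative (\<lambda>h. matrix_pairing h y)) (at x)"
  proof -
    have eq: "matrix_pairing h y = matrix_pairing h (det_gradient r x)" for h
      using has_derivative_unique[OF that D] by meson
    then have "y - det_gradient r x = 0"
      by (intro matrix_pairing_nondegenerate) (simp add: bilinear_rsub[OF bilinear_matrix_pairing])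
    then show ?thesis
      by simp
  qed
  moreover have "at x within {x. det x \<noteq> 0} = at x"
    using assms(2) by (intro at_within_open open_det_nonzero) simp
  ultimately show ?thesis
    using D by (auto simp: has_dual_derivative_def)
qed

text \<open>At a singular matrix the function vanishes while elsewhere it has a constant sign, so its
  derivative there, if any, is zero.\<close>

lemma has_dual_derivative_abs_det_powr_singular:
  fixes x y :: "real^'n^'n"
  assumes "det x = 0"
    and "has_dual_derivative matrix_pairing UNIV (\<lambda>x. c * \<bar>det x\<bar> powr a) x y"
  shows "y = 0"
proof -
  \<comment> \<open>Since \<open>0 powr a = 0\<close> for every \<open>a\<close>, negative ones
    included, \<open>x\<close> is a global extremum whose type depends on the sign of
    \<open>c\<close>.\<close>
  have "(\<forall>z\<in>UNIV. c * \<bar>det z\<bar> powr a \<le> c * \<bar>det x\<bar> powr a) \<or>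
      (\<forall>z\<in>UNIV. c * \<bar>det x\<bar> powr a \<le> c * \<bar>det z\<bar> powr a)"
    using assms(1) by (cases "0 \<le> c") (auto simp: mult_nonpos_nonneg)
  then have "(\<lambda>h. matrix_pairing h y) = (\<lambda>h. 0)"
    using assms(2) unfolding has_dual_derivative_def
    by (intro differential_zero_maxmin[of x UNIV]) auto
  then show ?thesis
    by (intro matrix_pairing_nondegenerate) meson
qed

text \<open>The transform lives on the invertible matrices, which the gradient map carries
  bijectively onto themselves; at singular matrices \<open>F\<close> may fail to be differentiable.
  The second conjunct covers every point of the whole space at which a derivative exists.\<close>

theorem proposition2:
  fixes p q :: real and F G :: "real^'n^'n \<Rightarrow> real"
  assumes "p \<noteq> 0" and "p \<noteq> 1" and "1 / p + 1 / q = 1"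
  defines "F \<equiv> \<lambda>x. real CARD('n) / p * \<bar>det x\<bar> powr (p / real CARD('n))"
    and "G \<equiv> \<lambda>y. real CARD('n) / q * \<bar>det y\<bar> powr (q / real CARD('n))"
  shows "is_Legendre_transform matrix_pairing {x. det x \<noteq> 0} F {y. det y \<noteq> 0} G \<and>
    (\<forall>x y. has_dual_derivative matrix_pairing UNIV F x y \<longrightarrow> matrix_pairing x y - F x = G y)"
proof -
  \<comment> \<open>With \<open>q = 0\<close> the convention \<open>1 / 0 = 0\<close> would turn the
    conjugacy relation into \<open>p = 1\<close>.\<close>
  have "q \<noteq> 0"
    using assms(2,3) by auto
  moreover from this have "p * q = p + q"
    using assms(1,3) by (simp add: field_simps)
  ultimately have q: "q \<noteq> 0" "(p - 1) * q = p" "(q - 1) * p = q"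
    by (simp_all add: algebra_simps)
  let ?D = "{x :: real^'n^'n. det x \<noteq> 0}"
  have dual: "has_dual_derivative matrix_pairing ?D F x y \<longleftrightarrow> y = det_gradient p x"
    if "det x \<noteq> 0" for x y
    unfolding F_def using assms(1) that by (rule has_dual_derivative_abs_det_powr_iff)
  have grad: "det (det_gradient r x) \<noteq> 0" if "det x \<noteq> 0" for r and x :: "real^'n^'n"
    using abs_det_det_gradient[OF that, of r] that by auto
  have Legendre: "matrix_pairing x (det_gradient p x) - F x = G (det_gradient p x)"
    if "det x \<noteq> 0" for x
  proof -
    let ?c = "\<bar>det x\<bar> powr (p / real CARD('n))"
    have "\<bar>det (det_gradient p x)\<bar> powr (q / real CARD('n)) = ?c"
      using q by (simp add: abs_det_det_gradient[OF that] powr_powr)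
    then have "G (det_gradient p x) = real CARD('n) * (1 / q) * ?c"
      by (simp add: G_def)
    \<comment> \<open>The pairing contributes the coefficient \<open>N\<close> and \<open>F\<close>
      subtracts \<open>N / p\<close>, leaving \<open>N / q\<close>.\<close>
    also have "1 / q = 1 - 1 / p"
      using assms(3) by simp
    finally show ?thesis
      by (simp add: matrix_pairing_det_gradient[OF that] F_def algebra_simps)
  qed
  have "is_Legendre_transform matrix_pairing ?D F ?D G"
    unfolding is_Legendre_transform_def
  proof (intro conjI)
    show "?D = {y. \<exists>x\<in>?D. has_dual_derivative matrix_pairing ?D F x y}"
    proof (intro set_eqI iffI)
      fix y assume "y \<in> ?D"
      \<comment> \<open>The preimage of \<open>y\<close> is its gradient for the conjugate
        exponent.\<close>
      then have "det_gradient p (det_gradient q y) = y" "det_gradient q y \<in> ?D"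
        using det_gradient_involution q(3) grad by auto
      then show "y \<in> {y. \<exists>x\<in>?D. has_dual_derivative matrix_pairing ?D F x y}"
        using dual by force
    next
      fix y assume "y \<in> {y. \<exists>x\<in>?D. has_dual_derivative matrix_pairing ?D F x y}"
      then show "y \<in> ?D"
        using dual grad by auto
    qed
    show "C1_on_submanifold ?D G"
      unfolding C1_on_submanifold_def
      using Ck_on_1_abs_det_powr open_det_nonzero G_def by blast
  qed (use dual Legendre in \<open>auto simp: duality_pairing_matrix_pairing smooth_submanifold_open
      open_det_nonzero\<close>)
  moreover have "matrix_pairing x y - F x = G y"
    if y: "has_dual_derivative matrix_pairing UNIV F x y" for x y
  proof (cases "det x = 0")
    case True
    then have "y = 0"
      using has_dual_derivative_abs_det_powr_singular y unfolding F_def by blast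
    \<comment> \<open>So \<open>F x\<close>, \<open>G y\<close> and the pairing are all 0, again by
      \<open>0 powr a = 0\<close>.\<close>
    moreover have "det (0 :: real^'n^'n) = 0"
      using det_scaleR[of 0 "mat 1 :: real^'n^'n"] by (simp add: power_0_left)
    ultimately show ?thesis
      using True by (simp add: F_def G_def matrix_pairing_def)
  next
    case False
    \<comment> \<open>A derivative on the whole space restricts to the invertible matrices, where
      the first part applies.\<close>
    have "has_dual_derivative matrix_pairing ?D F x y"
      using y unfolding has_dual_derivative_def by (rule has_derivative_subset) simp
    then show ?thesis
      using dual Legendre False by simp
  qed
  ultimately show ?thesis
    by blast
qed

end
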